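(* Let $H:\overline{\mathcal{M}}_1\to\overline{\mathcal{M}}_1$ be the hessian dynamical system on the compactified moduli space of elliptic curves, and identify $\overline{\mathcal{M}}_1$ with $\mathbb{P}^1=\mathbb{C}\cup\{\infty\}$ by means of the coordinate $h$ defined by $j=2^6\cdot 3^3\cdot h$, where $j$ is the $j$-invariant. Then for every integer $n\geq 1$ the iterate $H^{(n)}:=\underbrace{H\circ\cdots\circ H}_{n\text{ times}}$ is a ramified cover of $\overline{\mathcal{M}}_1=\mathbb{P}^1$ whose set of critical values is $\{h=0,\ h=1,\ h=\infty\}$.
   Context: Everything is over $\mathbb{C}$. For a homogeneous polynomial $f\in\mathbb{C}[x,y,z]$, $\mathrm{Hess}(f)$ is the determinant of the $3\times 3$ matrix of second partial derivatives of $f$. For a plane projective curve $C=Z(f)\subset\mathbb{P}^2$, $\mathrm{Hess}(C)$ is the curve defined by $\mathrm{Hess}(f)$; if $C$ is a cubic, $\mathrm{Hess}(f)$ again has degree $3$. The $j$-invariant is normalized so that the elliptic curve with affine equation $y^2=4x^3-g_2x-g_3$ (with $g_2^3-27g_3^2\neq 0$) has $j=1728\, g_2^3/(g_2^3-27g_3^2)$. The coarse moduli space $\mathcal{M}_1$ of elliptic curves is identified with the affine line with coordinate $j$, and $\overline{\mathcal{M}}_1\simeq\mathbb{P}^1$ is its compactification by one point $j=\infty$. The hessian dynamical system is the algebraic map $H:\overline{\mathcal{M}}_1\to\overline{\mathcal{M}}_1$ which associates to each elliptic curve the isomorphism type of the hessian of a smooth plane cubic corresponding to it. That is, $H$ is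 the unique algebraic morphism $\mathbb{P}^1\to\mathbb{P}^1$ such that $H(j(C))=j(\mathrm{Hess}(C))$ for every smooth plane cubic $C$ whose hessian curve $\mathrm{Hess}(C)$ is smooth. In terms of $h$ it is expressed by $h\mapsto -\frac{1}{27}\cdot\frac{(h-4)^3}{h^2}$. *)

theory Defs
  imports "HOL-Analysis.Analysis" "HOL-Computational_Algebra.Computational_Algebra"
begin

section \<open>The projective line\<close>

datatype P1 = Fin complex | Infty

definition P1_ratio :: "complex \<Rightarrow> complex \<Rightarrow> P1" where
  "P1_ratio a b = (if b = 0 then Infty else Fin (a / b))"

text \<open>
  A morphism of the projective line is \<open>[x : y] \<mapsto> [P(x,y) : Q(x,y)]\<close> with \<open>P, Q\<close> homogeneous of
  the same degree \<open>d\<close> and without common zero. Dehomogenising at \<open>y = 1\<close> gives coprime polynomials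
  \<open>p, q\<close> with \<open>d = max (degree p) (degree q)\<close>; the value at \<open>[1 : 0]\<close> is read off from the
  coefficients of degree \<open>d\<close>. Constant maps are included.
\<close>
definition P1_morphism :: "(P1 \<Rightarrow> P1) \<Rightarrow> bool" where
  "P1_morphism f \<longleftrightarrow> (\<exists>p q :: complex poly. coprime p q \<and>
     (\<forall>z. f (Fin z) = P1_ratio (poly p z) (poly q z)) \<and>
     (let d = max (degree p) (degree q) in f Infty = P1_ratio (coeff p d) (coeff q d)))"

text \<open>
  A ramified cover is a finite surjective morphism. Morphisms of the projective line are proper,
  so finiteness of a morphism amounts to finiteness of its fibres.
\<close>
definition ramified_cover :: "(P1 \<Rightarrow> P1) \<Rightarrow> bool" where
  "ramified_cover f \<longleftrightarrow> P1_morphism f \<and> surj f \<and> (\<forall>w. finite (f -` {w}))"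

text \<open>
  Inverse of a holomorphic chart centred at the given point: the coordinate is \<open>z - a\<close>
  at a finite point \<open>a\<close>, and \<open>1 / z\<close> at infinity.
\<close>
fun param_at :: "P1 \<Rightarrow> complex \<Rightarrow> P1" where
  "param_at (Fin a) t = Fin (a + t)"
| "param_at Infty t = P1_ratio 1 t"

text \<open>
  The chart itself. It is only meaningful near the centre; the values \<open>coord_at (Fin a) Infty\<close> and
  \<open>coord_at Infty (Fin 0)\<close> are irrelevant for derivatives at the centre.
\<close>
fun coord_at :: "P1 \<Rightarrow> P1 \<Rightarrow> complex" where
  "coord_at (Fin a) (Fin z) = z - a"
| "coord_at (Fin a) Infty = 0"
| "coord_at Infty (Fin z) = 1 / z"
| "coord_at Infty Infty = 0"

definition critical_point :: "(P1 \<Rightarrow> P1) \<Rightarrow> P1 \<Rightarrow> bool" where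
  "critical_point f x \<longleftrightarrow>
     ((\<lambda>t. coord_at (f x) (f (param_at x t))) has_field_derivative 0) (at 0)"

definition critical_values :: "(P1 \<Rightarrow> P1) \<Rightarrow> P1 set" where
  "critical_values f = f ` {x. critical_point f x}"

section \<open>Plane cubics and their hessians\<close>

text \<open>
  As \<open>\<complex>\<close> is infinite, homogeneous polynomials in three variables are identified with the
  functions they induce on \<open>\<complex>\<^sup>3\<close>.
\<close>
definition ternary_form :: "nat \<Rightarrow> (complex ^ 3 \<Rightarrow> complex) \<Rightarrow> bool" where
  "ternary_form d f \<longleftrightarrow> (\<exists>c :: nat \<Rightarrow> nat \<Rightarrow> complex. \<forall>v.
     f v = (\<Sum>i\<le>d. \<Sum>j\<le>d - i. c i j * (v $ 1) ^ i * (v $ 2) ^ j * (v $ 3) ^ (d - i - j)))"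

definition partial :: "3 \<Rightarrow> (complex ^ 3 \<Rightarrow> complex) \<Rightarrow> complex ^ 3 \<Rightarrow> complex" where
  "partial k f v = deriv (\<lambda>t. f (v + axis k t)) 0"

definition Hess :: "(complex ^ 3 \<Rightarrow> complex) \<Rightarrow> complex ^ 3 \<Rightarrow> complex" where
  "Hess f v = det ((\<chi> i j. partial i (partial j f) v) :: complex ^ 3 ^ 3)"

text \<open>Smoothness of the cubic curve \<open>Z(f)\<close>; it forces \<open>f \<noteq> 0\<close>.\<close>
definition smooth_cubic :: "(complex ^ 3 \<Rightarrow> complex) \<Rightarrow> bool" where
  "smooth_cubic f \<longleftrightarrow> ternary_form 3 f \<and>
     \<not> (\<exists>v. v \<noteq> 0 \<and> f v = 0 \<and> (\<forall>k. partial k f v = 0))"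

text \<open>The projective closure of \<open>y\<^sup>2 = 4 x\<^sup>3 - g\<^sub>2 x - g\<^sub>3\<close>.\<close>
definition weierstrass_cubic :: "complex \<Rightarrow> complex \<Rightarrow> complex ^ 3 \<Rightarrow> complex" where
  "weierstrass_cubic g2 g3 v =
     (v $ 2)\<^sup>2 * v $ 3 - (4 * (v $ 1) ^ 3 - g2 * v $ 1 * (v $ 3)\<^sup>2 - g3 * (v $ 3) ^ 3)"

definition projectively_equivalent ::
    "(complex ^ 3 \<Rightarrow> complex) \<Rightarrow> (complex ^ 3 \<Rightarrow> complex) \<Rightarrow> bool" where
  "projectively_equivalent f g \<longleftrightarrow>
     (\<exists>(A :: complex ^ 3 ^ 3) c. invertible A \<and> c \<noteq> 0 \<and> (\<forall>v. f (A *v v) = c * g v))"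

text \<open>
  \<open>has_j_invariant f j\<close>: the plane cubic \<open>Z(f)\<close> is isomorphic to a curve in Weierstrass form whose
  \<open>j\<close>-invariant is \<open>j\<close>. For smooth plane cubics, isomorphism is the same as projective
  equivalence, and every smooth plane cubic has exactly one \<open>j\<close>-invariant.
\<close>
definition has_j_invariant :: "(complex ^ 3 \<Rightarrow> complex) \<Rightarrow> complex \<Rightarrow> bool" where
  "has_j_invariant f j \<longleftrightarrow> (\<exists>g2 g3. g2 ^ 3 - 27 * g3\<^sup>2 \<noteq> 0 \<and>
     projectively_equivalent f (weierstrass_cubic g2 g3) \<and>
     j = 1728 * g2 ^ 3 / (g2 ^ 3 - 27 * g3\<^sup>2))"

section \<open>The hessian dynamical system\<close>

text \<open>In \<open>hessian_map\<close>, \<open>P1\<close> is the compactified moduli space with coordinate \<open>j\<close>.\<close>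
definition hessian_map :: "P1 \<Rightarrow> P1" where
  "hessian_map = (THE H. P1_morphism H \<and>
     (\<forall>f. smooth_cubic f \<and> smooth_cubic (Hess f) \<longrightarrow>
       (\<forall>j j'. has_j_invariant f j \<and> has_j_invariant (Hess f) j' \<longrightarrow> H (Fin j) = Fin j')))"

fun h_of_j :: "P1 \<Rightarrow> P1" where
  "h_of_j (Fin j) = Fin (j / (2 ^ 6 * 3 ^ 3))"
| "h_of_j Infty = Infty"

fun j_of_h :: "P1 \<Rightarrow> P1" where
  "j_of_h (Fin h) = Fin (2 ^ 6 * 3 ^ 3 * h)"
| "j_of_h Infty = Infty"

text \<open>The hessian dynamical system expressed in the coordinate \<open>h\<close>.\<close>
definition hessian_map_h :: "P1 \<Rightarrow> P1" where
  "hessian_map_h = h_of_j \<circ> hessian_map \<circ> j_of_h"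

end

theory Submission
  imports Defs "HOL-Computational_Algebra.Field_as_Ring"
begin

text \<open>
  Two facts carry the proof: in the coordinate \<open>h\<close> the hessian dynamical system is the cubic map
  \<open>h \<mapsto> - (h - 4)\<^sup>3 / (27 h\<^sup>2)\<close>, and this map is postcritically finite with postcritical set
  \<open>{0, 1, \<infinity>}\<close>.

  The closed form (\<open>hessian_map_eq\<close>, \<open>hessian_map_h_eq\<close>). By the chain rule
  \<open>Hess (f \<circ> A) = (det A)\<^sup>2 (Hess f \<circ> A)\<close>, so projectively equivalent cubics have projectively
  equivalent hessians and it suffices to treat Weierstrass cubics. The hessian of
  \<open>y\<^sup>2 z = 4 x\<^sup>3 - g\<^sub>2 x z\<^sup>2 - g\<^sub>3 z\<^sup>3\<close> is singular when \<open>g\<^sub>2 = 0\<close>. Otherwise, exchanging \<open>x\<close> and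
  \<open>z\<close> and completing the cube brings it to Weierstrass form (\<open>Hess_weierstrass_normal_form\<close>), from
  which its j-invariant is read off. For this to determine the value of the dynamical system, the
  j-invariant must not depend on the chosen Weierstrass form. This follows without any geometry of
  flexes: if \<open>W\<close> is a Weierstrass cubic then \<open>Hess (W + s Hess W)\<close> lies again in the pencil spanned by
  \<open>W\<close> and \<open>Hess W\<close>, and its coordinate along \<open>W\<close> is a polynomial in \<open>s\<close> whose coefficients are, up to
  numerical factors, \<open>g\<^sub>2\<close>, \<open>g\<^sub>3\<close> and \<open>g\<^sub>2\<^sup>2\<close> (\<open>Hess_pencil\<close>). A projective equivalence only rescales \<open>s\<close>,
  say by \<open>k\<close>, so it multiplies \<open>g\<^sub>2\<close> by \<open>k\<^sup>2\<close> and \<open>g\<^sub>3\<close> by \<open>k\<^sup>3\<close>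
  (\<open>weierstrass_equivalent_coefficients\<close>), which leaves the j-invariant unchanged. Uniqueness of the
  dynamical system holds because every nonzero \<open>j\<close> occurs for a cubic with smooth hessian, and two
  morphisms of the projective line that agree at infinitely many points are equal
  (\<open>P1_morphism_eqI\<close>).

  The dynamics. The derivative of the cubic map in charts vanishes exactly at \<open>4\<close>, \<open>-8\<close> and \<open>0\<close>
  (\<open>hess_formula_chart_derivative\<close>), whose images are \<open>0\<close>, \<open>1\<close> and \<open>\<infinity>\<close>; moreover \<open>0\<close> goes to
  \<open>\<infinity>\<close>, while \<open>1\<close> and \<open>\<infinity>\<close> are fixed. By the chain rule a point is critical for the n-th iterate iff
  its orbit meets \<open>{0, 4, -8}\<close> within the first \<open>n\<close> points. Hence all critical values of the iterate lie
  in the forward-invariant set \<open>{0, 1, \<infinity>}\<close>, and all three occur, since the previous iterate is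
  surjective and so reaches \<open>4\<close>, \<open>-8\<close> and \<open>0\<close>.
\<close>

(* This leaves the symbol $ to vector components. *)
no_notation fps_nth (infixl \<open>$\<close> 75)


section \<open>Polynomial functions and their partial derivatives\<close>

text \<open>
  Forms and all their iterated partial derivatives stay in this class, whose inductive
  presentation makes differentiability and the chain rule a structural induction.
\<close>
inductive poly_fun :: "(complex ^ 3 \<Rightarrow> complex) \<Rightarrow> bool" where
  const: "poly_fun (\<lambda>_. c)"
| coord: "poly_fun (\<lambda>v. v $ k)"
| add: "poly_fun f \<Longrightarrow> poly_fun g \<Longrightarrow> poly_fun (\<lambda>v. f v + g v)"
| mult: "poly_fun f \<Longrightarrow> poly_fun g \<Longrightarrow> poly_fun (\<lambda>v. f v * g v)"

lemma poly_fun_sum: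
  "(\<And>i. i \<in> I \<Longrightarrow> poly_fun (f i)) \<Longrightarrow> poly_fun (\<lambda>v. \<Sum>i\<in>I. f i v)"
  by (induction I rule: infinite_finite_induct) (auto intro: poly_fun.intros)

lemma poly_fun_power: "poly_fun f \<Longrightarrow> poly_fun (\<lambda>v. f v ^ n)"
  by (induction n) (auto intro: poly_fun.intros)

lemma poly_fun_diff:
  assumes "poly_fun f" "poly_fun g"
  shows "poly_fun (\<lambda>v. f v - g v)"
  using poly_fun.add[OF assms(1) poly_fun.mult[OF poly_fun.const[of "-1"] assms(2)]] by simp

lemmas poly_fun_intros = poly_fun.intros poly_fun_sum poly_fun_power poly_fun_diff

lemma poly_fun_linear_substitution:
  "poly_fun f \<Longrightarrow> poly_fun (\<lambda>v. f (A *v v))"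
  by (induction rule: poly_fun.induct)
    (auto simp: matrix_vector_mult_def intro!: poly_fun_intros)

lemma ternary_form_poly_fun:
  assumes "ternary_form d f"
  shows "poly_fun f"
proof -
  obtain c where "\<forall>v. f v = (\<Sum>i\<le>d. \<Sum>j\<le>d - i. c i j * (v $ 1) ^ i * (v $ 2) ^ j * (v $ 3) ^ (d - i - j))"
    using assms unfolding ternary_form_def by blast
  then have "f = (\<lambda>v. \<Sum>i\<le>d. \<Sum>j\<le>d - i. c i j * (v $ 1) ^ i * (v $ 2) ^ j * (v $ 3) ^ (d - i - j))"
    by auto
  then show ?thesis
    by (auto intro!: poly_fun_intros)
qed

lemma scaled_axis: "axis k t = t *s (axis k 1 :: complex ^ 3)"
  by (simp add: vec_eq_iff axis_def)

lemma sum_axis: "(\<Sum>j\<in>UNIV. axis k (1::complex) $ j * g j) = g (k :: 3)"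
proof -
  have "(\<Sum>j\<in>UNIV. axis k (1::complex) $ j * g j) = (\<Sum>j\<in>UNIV. if j = k then g j else 0)"
    by (intro sum.cong) (auto simp: axis_def)
  then show ?thesis by simp
qed

text \<open>
  The gradient is built by structural induction, with the sum and product rules; the statement about
  all directions at once is what later gives the chain rule for linear substitutions.
\<close>
lemma poly_fun_has_gradient:
  assumes "poly_fun f"
  shows "\<exists>g. (\<forall>k. poly_fun (g k)) \<and>
    (\<forall>v w. ((\<lambda>t. f (v + t *s w)) has_field_derivative (\<Sum>k\<in>UNIV. w $ k * g k v)) (at 0))"
  using assms
proof (induction rule: poly_fun.induct)
  case (const c)
  show ?case
    by (rule exI[of _ "\<lambda>_ _. 0"]) (auto intro: poly_fun_intros)
next
  case (coord k)
  have "(\<Sum>j\<in>UNIV. w $ j * (if j = k then 1 else 0)) = w $ k" for w :: "complex ^ 3"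
    by (simp add: if_distrib cong: if_cong)
  then show ?case
    by (intro exI[of _ "\<lambda>j _. if j = k then 1 else 0"])
      (auto intro!: poly_fun_intros derivative_eq_intros)
next
  case (add f1 f2)
  then obtain g1 g2 where g: "\<forall>k. poly_fun (g1 k)" "\<forall>k. poly_fun (g2 k)"
    "\<And>v w. ((\<lambda>t. f1 (v + t *s w)) has_field_derivative (\<Sum>k\<in>UNIV. w $ k * g1 k v)) (at 0)"
    "\<And>v w. ((\<lambda>t. f2 (v + t *s w)) has_field_derivative (\<Sum>k\<in>UNIV. w $ k * g2 k v)) (at 0)"
    by blast
  have "((\<lambda>t. f1 (v + t *s w) + f2 (v + t *s w)) has_field_derivative
      (\<Sum>k\<in>UNIV. w $ k * (g1 k v + g2 k v))) (at 0)" for v w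
    using DERIV_add[OF g(3)[of v w] g(4)[of v w]]
    by (simp add: sum.distrib distrib_left)
  then show ?case
    using g(1,2) by (intro exI[of _ "\<lambda>k v. g1 k v + g2 k v"]) (auto intro: poly_fun_intros)
next
  case (mult f1 f2)
  then obtain g1 g2 where g: "\<forall>k. poly_fun (g1 k)" "\<forall>k. poly_fun (g2 k)"
    "\<And>v w. ((\<lambda>t. f1 (v + t *s w)) has_field_derivative (\<Sum>k\<in>UNIV. w $ k * g1 k v)) (at 0)"
    "\<And>v w. ((\<lambda>t. f2 (v + t *s w)) has_field_derivative (\<Sum>k\<in>UNIV. w $ k * g2 k v)) (at 0)"
    by blast
  have "((\<lambda>t. f1 (v + t *s w) * f2 (v + t *s w)) has_field_derivative
      (\<Sum>k\<in>UNIV. w $ k * (g1 k v * f2 v + g2 k v * f1 v))) (at 0)" for v w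
    using DERIV_mult[OF g(3)[of v w] g(4)[of v w]]
    by (simp add: sum.distrib sum_distrib_left sum_distrib_right algebra_simps)
  then show ?case
    using g(1,2) mult.hyps
    by (intro exI[of _ "\<lambda>k v. g1 k v * f2 v + g2 k v * f1 v"]) (auto intro!: poly_fun_intros)
qed

lemma partial_eqI:
  "((\<lambda>t. f (v + axis k t)) has_field_derivative D) (at 0) \<Longrightarrow> partial k f v = D"
  unfolding partial_def by (rule DERIV_imp_deriv)

lemma
  assumes "poly_fun f"
  shows poly_fun_partial: "poly_fun (partial k f)"
    and directional_derivative:
      "((\<lambda>t. f (v + t *s w)) has_field_derivative (\<Sum>k\<in>UNIV. w $ k * partial k f v)) (at 0)"
proof -
  obtain g where g: "\<And>k. poly_fun (g k)"
    "\<And>v w. ((\<lambda>t. f (v + t *s w)) has_field_derivative (\<Sum>k\<in>UNIV. w $ k * g k v)) (at 0)"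
    using poly_fun_has_gradient[OF assms] by blast
  have "partial k f v = g k v" for k v
    using g(2)[of v "axis k 1"]
    by (intro partial_eqI) (simp only: scaled_axis[symmetric] sum_axis)
  then have "partial k f = g k" for k by auto
  then show "poly_fun (partial k f)"
    "((\<lambda>t. f (v + t *s w)) has_field_derivative (\<Sum>k\<in>UNIV. w $ k * partial k f v)) (at 0)"
    using g by auto
qed

lemma has_partial:
  assumes "poly_fun f"
  shows "((\<lambda>t. f (v + axis k t)) has_field_derivative partial k f v) (at 0)"
  using directional_derivative[OF assms, of v "axis k 1"]
  by (simp only: scaled_axis[symmetric] sum_axis)

lemma partial_lincomb:
  assumes "\<And>i. i \<in> I \<Longrightarrow> poly_fun (f i)"
  shows "partial k (\<lambda>v. \<Sum>i\<in>I. c i * f i v) = (\<lambda>v. \<Sum>i\<in>I. c i * partial k (f i) v)"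
  by (intro ext partial_eqI DERIV_sum DERIV_cmult has_partial assms)

lemma partial_scale:
  assumes "poly_fun f"
  shows "partial k (\<lambda>v. c * f v) = (\<lambda>v. c * partial k f v)"
  by (intro ext partial_eqI DERIV_cmult has_partial assms)

lemma partial_linear_substitution:
  assumes "poly_fun f"
  shows "partial j (\<lambda>v. f (A *v v)) = (\<lambda>v. \<Sum>k\<in>UNIV. A $ k $ j * partial k f (A *v v))"
proof (intro ext partial_eqI)
  fix v
  have "(A *v axis j 1) $ i = A $ i $ j" for i
    using sum_axis[of j "\<lambda>k. A $ i $ k"] by (simp add: matrix_vector_mult_def mult.commute)
  then have "A *v axis j 1 = column j A"
    by (simp add: vec_eq_iff column_def)
  then have "A *v (v + axis j t) = A *v v + t *s column j A" for t
    by (subst scaled_axis) (simp add: matrix_vector_right_distrib vector_scalar_commute)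
  then show "((\<lambda>t. f (A *v (v + axis j t))) has_field_derivative
      (\<Sum>k\<in>UNIV. A $ k $ j * partial k f (A *v v))) (at 0)"
    using directional_derivative[OF assms, of "A *v v" "column j A"]
    by (simp add: column_def)
qed

section \<open>The hessian under linear substitutions\<close>

lemma poly_fun_Hess:
  assumes "poly_fun f"
  shows "poly_fun (Hess f)"
proof -
  have "Hess f = (\<lambda>v. det ((\<chi> i j. partial i (partial j f) v) :: complex ^ 3 ^ 3))"
    by (auto simp: Hess_def)
  then show ?thesis
    using assms by (auto simp: det_3 intro!: poly_fun_intros poly_fun_partial)
qed

text \<open>
  The chain rule turns the hessian matrix into \<open>A\<^sup>T M A\<close>, where \<open>M\<close> is the hessian matrix of \<open>f\<close> at the
  point \<open>A v\<close>.
\<close>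
lemma Hess_linear_substitution:
  assumes f: "poly_fun f"
  shows "Hess (\<lambda>v. f (A *v v)) v = (det A)\<^sup>2 * Hess f (A *v v)"
proof -
  define M :: "complex ^ 3 ^ 3" where "M = (\<chi> i j. partial i (partial j f) (A *v v))"
  have "partial i (partial j (\<lambda>v. f (A *v v))) v =
      (\<Sum>k\<in>UNIV. A $ k $ j * (\<Sum>l\<in>UNIV. A $ l $ i * partial l (partial k f) (A *v v)))" for i j
    by (simp add: f partial_linear_substitution partial_lincomb poly_fun_partial
        poly_fun_linear_substitution)
  then have "(\<chi> i j. partial i (partial j (\<lambda>v. f (A *v v))) v) = transpose A ** M ** A"
    by (simp add: vec_eq_iff M_def matrix_matrix_mult_def transpose_def mult.commute)
  then show ?thesis
    by (simp add: Hess_def det_mul det_transpose M_def power2_eq_square)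
qed

lemma Hess_scale:
  assumes "poly_fun f"
  shows "Hess (\<lambda>v. c * f v) v = c ^ 3 * Hess f v"
  using assms
  by (simp add: Hess_def partial_scale poly_fun_partial det_3) algebra

lemma projectively_equivalent_refl: "projectively_equivalent f f"
  unfolding projectively_equivalent_def
  by (intro exI[of _ "mat 1"] exI[of _ 1]) (auto simp: invertible_def intro: exI[of _ "mat 1"])

lemma projectively_equivalent_sym:
  assumes "projectively_equivalent f g"
  shows "projectively_equivalent g f"
proof -
  obtain A c where A: "invertible A" "c \<noteq> 0" "\<And>v. f (A *v v) = c * g v"
    using assms unfolding projectively_equivalent_def by blast
  then obtain B where B: "A ** B = mat 1" "B ** A = mat 1"
    unfolding invertible_def by blast
  have "g (B *v v) = (1 / c) * f v" for v
  proof -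
    have "A *v (B *v v) = v" by (simp add: matrix_vector_mul_assoc B)
    then show ?thesis using A(2) A(3)[of "B *v v"] by simp
  qed
  moreover have "invertible B" using B unfolding invertible_def by blast
  ultimately show ?thesis
    using A(2) unfolding projectively_equivalent_def
    by (intro exI[of _ B] exI[of _ "1 / c"]) auto
qed

lemma projectively_equivalent_trans:
  assumes "projectively_equivalent f g" "projectively_equivalent g h"
  shows "projectively_equivalent f h"
proof -
  obtain A c where A: "invertible A" "c \<noteq> 0" "\<And>v. f (A *v v) = c * g v"
    using assms(1) unfolding projectively_equivalent_def by blast
  obtain B d where B: "invertible B" "d \<noteq> 0" "\<And>v. g (B *v v) = d * h v"
    using assms(2) unfolding projectively_equivalent_def by blast
  have "f ((A ** B) *v v) = (c * d) * h v" for v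
    by (simp add: matrix_vector_mul_assoc[symmetric] A B)
  then show ?thesis
    using A B unfolding projectively_equivalent_def
    by (intro exI[of _ "A ** B"] exI[of _ "c * d"]) (auto intro: invertible_mult)
qed

lemma Hess_of_substitution:
  assumes f: "poly_fun f" and g: "poly_fun g" and eq: "\<And>v. f (A *v v) = c * g v"
  shows "(det A)\<^sup>2 * Hess f (A *v v) = c ^ 3 * Hess g v"
proof -
  have "(\<lambda>v. f (A *v v)) = (\<lambda>v. c * g v)" using eq by auto
  then show ?thesis
    using Hess_linear_substitution[OF f, of A v] Hess_scale[OF g, of c v] by simp
qed

lemma projectively_equivalent_Hess:
  assumes "poly_fun f" "poly_fun g" "projectively_equivalent f g"
  shows "projectively_equivalent (Hess f) (Hess g)"
proof -
  obtain A c where A: "invertible A" "c \<noteq> 0" "\<And>v. f (A *v v) = c * g v"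
    using assms(3) unfolding projectively_equivalent_def by blast
  have d: "det A \<noteq> 0" using A(1) invertible_det_nz by blast
  have "Hess f (A *v v) = (c ^ 3 / (det A)\<^sup>2) * Hess g v" for v
    using Hess_of_substitution[OF assms(1,2) A(3), of v] d by (simp add: field_simps)
  then show ?thesis
    using A(1,2) d unfolding projectively_equivalent_def
    by (intro exI[of _ A] exI[of _ "c ^ 3 / (det A)\<^sup>2"]) auto
qed

section \<open>Singular points\<close>

definition singular_point :: "(complex ^ 3 \<Rightarrow> complex) \<Rightarrow> complex ^ 3 \<Rightarrow> bool" where
  "singular_point f v \<longleftrightarrow> v \<noteq> 0 \<and> f v = 0 \<and> (\<forall>k. partial k f v = 0)"

lemma smooth_cubic_iff: "smooth_cubic f \<longleftrightarrow> ternary_form 3 f \<and> (\<forall>v. \<not> singular_point f v)"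
  by (auto simp: smooth_cubic_def singular_point_def)

text \<open>
  The gradient of \<open>g = (1 / c) (f \<circ> A)\<close> is a linear image of that of \<open>f\<close>, so it vanishes
  at the preimage of a singular point.
\<close>
lemma singular_point_transfer:
  assumes f: "poly_fun f" and eq: "projectively_equivalent g f" and v: "singular_point f v"
  shows "\<exists>w. singular_point g w"
proof -
  obtain A c where A: "invertible A" "c \<noteq> 0" "\<And>v. f (A *v v) = c * g v"
    using projectively_equivalent_sym[OF eq] unfolding projectively_equivalent_def by blast
  then obtain B where B: "A ** B = mat 1"
    unfolding invertible_def by blast
  have AB: "A *v (B *v v) = v" by (simp add: matrix_vector_mul_assoc B)
  have g: "g = (\<lambda>v. (1 / c) * f (A *v v))" using A(2,3) by auto
  have "partial k g (B *v v) = 0" for k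
    using v unfolding singular_point_def
    by (subst g, subst partial_scale)
      (auto simp: f poly_fun_linear_substitution partial_linear_substitution AB)
  moreover have "B *v v \<noteq> 0"
    using v AB by (auto simp: singular_point_def)
  moreover have "g (B *v v) = 0"
    using v by (simp add: g AB singular_point_def)
  ultimately show ?thesis
    unfolding singular_point_def by blast
qed

section \<open>Cubics even in the second coordinate\<close>

text \<open>
  The cubics invariant under the reflection \<open>y \<mapsto> - y\<close>. They contain the Weierstrass
  cubics and, since the hessian is covariant, are stable under taking hessians.
\<close>
definition even_cubic ::
    "complex \<Rightarrow> complex \<Rightarrow> complex \<Rightarrow> complex \<Rightarrow> complex \<Rightarrow> complex \<Rightarrow> complex ^ 3 \<Rightarrow> complex" where
  "even_cubic p q a b c d v = (v $ 2)\<^sup>2 * (p * v $ 3 + q * v $ 1)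
     + a * (v $ 1) ^ 3 + b * (v $ 1)\<^sup>2 * v $ 3 + c * v $ 1 * (v $ 3)\<^sup>2 + d * (v $ 3) ^ 3"

lemma axis_components:
  "axis (1::3) (t::complex) $ 1 = t" "axis (1::3) (t::complex) $ 2 = 0" "axis (1::3) (t::complex) $ 3 = 0"
  "axis (2::3) (t::complex) $ 1 = 0" "axis (2::3) (t::complex) $ 2 = t" "axis (2::3) (t::complex) $ 3 = 0"
  "axis (3::3) (t::complex) $ 1 = 0" "axis (3::3) (t::complex) $ 2 = 0" "axis (3::3) (t::complex) $ 3 = t"
  by (auto simp: axis_def)

lemma partial_even_cubic:
  "partial 1 (even_cubic p q a b c d) =
     (\<lambda>v. q * (v $ 2)\<^sup>2 + 3 * a * (v $ 1)\<^sup>2 + 2 * b * v $ 1 * v $ 3 + c * (v $ 3)\<^sup>2)"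
  "partial 2 (even_cubic p q a b c d) = (\<lambda>v. 2 * v $ 2 * (p * v $ 3 + q * v $ 1))"
  "partial 3 (even_cubic p q a b c d) =
     (\<lambda>v. p * (v $ 2)\<^sup>2 + b * (v $ 1)\<^sup>2 + 2 * c * v $ 1 * v $ 3 + 3 * d * (v $ 3)\<^sup>2)"
  unfolding even_cubic_def
  by (intro ext partial_eqI; auto intro!: derivative_eq_intros
      simp: axis_components algebra_simps power2_eq_square)+

lemma Hess_even_cubic:
  "Hess (even_cubic p q a b c d) = even_cubic
     (16 * p * q * c - 8 * p\<^sup>2 * b - 24 * q\<^sup>2 * d)
     (16 * p * q * b - 24 * p\<^sup>2 * a - 8 * q\<^sup>2 * c)
     (8 * q * (3 * a * c - b\<^sup>2))
     (8 * p * (3 * a * c - b\<^sup>2) + 8 * q * (9 * a * d - b * c))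
     (8 * p * (9 * a * d - b * c) + 8 * q * (3 * b * d - c\<^sup>2))
     (8 * p * (3 * b * d - c\<^sup>2))" (is "_ = ?h")
proof
  fix v :: "complex ^ 3"
  let ?f = "even_cubic p q a b c d"
  let ?x = "v $ 1" and ?y = "v $ 2" and ?z = "v $ 3"
  have "partial 1 (partial 1 ?f) v = 6 * a * ?x + 2 * b * ?z"
    "partial 1 (partial 2 ?f) v = 2 * q * ?y"
    "partial 1 (partial 3 ?f) v = 2 * b * ?x + 2 * c * ?z"
    "partial 2 (partial 1 ?f) v = 2 * q * ?y"
    "partial 2 (partial 2 ?f) v = 2 * (p * ?z + q * ?x)"
    "partial 2 (partial 3 ?f) v = 2 * p * ?y"
    "partial 3 (partial 1 ?f) v = 2 * b * ?x + 2 * c * ?z"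
    "partial 3 (partial 2 ?f) v = 2 * p * ?y"
    "partial 3 (partial 3 ?f) v = 2 * c * ?x + 6 * d * ?z"
    unfolding partial_even_cubic
    by (rule partial_eqI; auto intro!: derivative_eq_intros
        simp: axis_components algebra_simps power2_eq_square)+
  then have "Hess ?f v =
      (6 * a * ?x + 2 * b * ?z) * (2 * (p * ?z + q * ?x)) * (2 * c * ?x + 6 * d * ?z)
      + 2 * (2 * q * ?y) * (2 * p * ?y) * (2 * b * ?x + 2 * c * ?z)
      - (6 * a * ?x + 2 * b * ?z) * (2 * p * ?y)\<^sup>2
      - (2 * q * ?y)\<^sup>2 * (2 * c * ?x + 6 * d * ?z)
      - (2 * b * ?x + 2 * c * ?z)\<^sup>2 * (2 * (p * ?z + q * ?x))"
    by (simp add: Hess_def det_3 power2_eq_square)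
  also have "\<dots> = ?h v"
    unfolding even_cubic_def by algebra
  finally show "Hess ?f v = ?h v" .
qed

lemma ternary_form_even_cubic: "ternary_form 3 (even_cubic p q a b c d)"
  unfolding ternary_form_def even_cubic_def
  by (rule exI[of _ "\<lambda>i j. if j = 2 then (if i = 0 then p else q) else if j = 0 then [d, c, b, a] ! i else 0"])
    (auto simp: eval_nat_numeral algebra_simps)

lemma poly_fun_even_cubic: "poly_fun (even_cubic p q a b c d)"
  by (rule ternary_form_poly_fun[OF ternary_form_even_cubic])

section \<open>Invariance of the j-invariant and the hessian of a Weierstrass cubic\<close>

lemma weierstrass_even_cubic: "weierstrass_cubic g2 g3 = even_cubic 1 0 (-4) 0 g2 g3"
  by (auto simp: weierstrass_cubic_def even_cubic_def fun_eq_iff algebra_simps)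

lemma poly_fun_weierstrass: "poly_fun (weierstrass_cubic g2 g3)"
  by (simp add: weierstrass_even_cubic poly_fun_even_cubic)

lemma Hess_weierstrass:
  "Hess (weierstrass_cubic g2 g3) = even_cubic 0 96 0 (- 96 * g2) (- 288 * g3) (- 8 * g2\<^sup>2)"
  by (simp add: weierstrass_even_cubic Hess_even_cubic)

text \<open>
  For smooth \<open>W\<close>, all smooth members of its Hesse pencil have the same nine flexes and the pencil
  consists of all cubics through these, so it is stable under \<open>Hess\<close>. The coefficients are invariants
  of \<open>W\<close>, hence polynomials in \<open>g\<^sub>2\<close> and \<open>g\<^sub>3\<close>.
\<close>
lemma Hess_pencil:
  "Hess (\<lambda>v. weierstrass_cubic g2 g3 v + s * Hess (weierstrass_cubic g2 g3) v) v =
     (2304 * g2 * s - 663552 * g3 * s\<^sup>2 + 1769472 * g2\<^sup>2 * s ^ 3) * weierstrass_cubic g2 g3 v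
     + (1 - 2304 * g2 * s\<^sup>2 + 221184 * g3 * s ^ 3) * Hess (weierstrass_cubic g2 g3) v" (is "_ = ?r")
proof -
  have "(\<lambda>v. weierstrass_cubic g2 g3 v + s * Hess (weierstrass_cubic g2 g3) v) =
      even_cubic 1 (96 * s) (-4) (- 96 * g2 * s) (g2 - 288 * g3 * s) (g3 - 8 * g2\<^sup>2 * s)"
    unfolding Hess_weierstrass unfolding weierstrass_even_cubic even_cubic_def
    by (auto simp: fun_eq_iff algebra_simps)
  then have "Hess (\<lambda>v. weierstrass_cubic g2 g3 v + s * Hess (weierstrass_cubic g2 g3) v) v =
      Hess (even_cubic 1 (96 * s) (-4) (- 96 * g2 * s) (g2 - 288 * g3 * s) (g3 - 8 * g2\<^sup>2 * s)) v"
    by (rule arg_cong)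
  also have "\<dots> = ?r"
    unfolding Hess_even_cubic Hess_weierstrass weierstrass_even_cubic even_cubic_def
    by (simp add: algebra_simps power2_eq_square power3_eq_cube)
  finally show ?thesis .
qed

text \<open>
  If \<open>W \<circ> A = c W'\<close> then \<open>Hess W \<circ> A = c k Hess W'\<close> with \<open>k = (c / det A)\<^sup>2\<close>, so that \<open>A\<close> carries the pencil
  of \<open>W\<close> to that of \<open>W'\<close> and multiplies the parameter by \<open>k\<close>. Expanding the hessian of \<open>W + s Hess W\<close> in
  both pencils and comparing the coefficients of \<open>W'\<close> as polynomials in \<open>s\<close> gives the claim.
\<close>
lemma weierstrass_equivalent_coefficients:
  assumes "projectively_equivalent (weierstrass_cubic g2 g3) (weierstrass_cubic g2' g3')"
  shows "\<exists>k. k \<noteq> 0 \<and> g2 = k\<^sup>2 * g2' \<and> g3 = k ^ 3 * g3'"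
proof -
  define W W' where "W = weierstrass_cubic g2 g3" and "W' = weierstrass_cubic g2' g3'"
  define \<alpha> where "\<alpha> g2 g3 s = 2304 * g2 * s - 663552 * g3 * s\<^sup>2 + 1769472 * g2\<^sup>2 * s ^ 3"
    for g2 g3 s :: complex
  define \<beta> where "\<beta> g2 g3 s = 1 - 2304 * g2 * s\<^sup>2 + 221184 * g3 * s ^ 3"
    for g2 g3 s :: complex
  obtain A c where A: "invertible A" "c \<noteq> 0" "\<And>v. W (A *v v) = c * W' v"
    using assms unfolding projectively_equivalent_def W_def W'_def by blast
  define d where "d = det A"
  have d: "d \<noteq> 0" using A(1) by (simp add: d_def invertible_det_nz)
  define k where "k = c\<^sup>2 / d\<^sup>2"
  have k: "k \<noteq> 0" using A(2) d by (simp add: k_def)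
  have W: "poly_fun W" "poly_fun W'" "poly_fun (Hess W)" "poly_fun (Hess W')"
    by (auto simp: W_def W'_def poly_fun_weierstrass poly_fun_Hess)
  have H: "Hess W (A *v v) = c * k * Hess W' v" for v
    using Hess_of_substitution[OF W(1,2) A(3), of v] d
    by (simp add: d_def[symmetric] k_def field_simps power2_eq_square power3_eq_cube)
  have main: "\<alpha> g2 g3 s * W' v + \<beta> g2 g3 s * k * Hess W' v
      = k * \<alpha> g2' g3' (s * k) * W' v + k * \<beta> g2' g3' (s * k) * Hess W' v" for s v
  proof -
    have "W (A *v v) + s * Hess W (A *v v) = c * (W' v + (s * k) * Hess W' v)" for v
      by (simp add: A(3) H algebra_simps)
    then have "d\<^sup>2 * Hess (\<lambda>v. W v + s * Hess W v) (A *v v) =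
        c ^ 3 * Hess (\<lambda>v. W' v + (s * k) * Hess W' v) v"
      unfolding d_def by (intro Hess_of_substitution poly_fun_intros W)
    then have "d\<^sup>2 * (\<alpha> g2 g3 s * (c * W' v) + \<beta> g2 g3 s * (c * k * Hess W' v)) =
        c ^ 3 * (\<alpha> g2' g3' (s * k) * W' v + \<beta> g2' g3' (s * k) * Hess W' v)"
      unfolding W_def W'_def Hess_pencil
      unfolding W_def[symmetric] W'_def[symmetric] \<alpha>_def[symmetric] \<beta>_def[symmetric]
      by (simp only: A(3) H)
    moreover have "c ^ 3 = d\<^sup>2 * (c * k)"
      using d by (simp add: k_def field_simps power2_eq_square power3_eq_cube)
    ultimately have "(d\<^sup>2 * c) * (\<alpha> g2 g3 s * W' v + \<beta> g2 g3 s * k * Hess W' v)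
      = (d\<^sup>2 * c) * (k * \<alpha> g2' g3' (s * k) * W' v + k * \<beta> g2' g3' (s * k) * Hess W' v)"
      by (simp add: algebra_simps)
    then show ?thesis using d A(2) by simp
  qed
  have \<alpha>: "\<alpha> g2 g3 s = k * \<alpha> g2' g3' (s * k)" for s
  proof -
    \<comment> \<open>The point \<open>[1 : 0 : 0]\<close> isolates the coefficient of \<open>W'\<close>, as \<open>Hess W'\<close> vanishes there.\<close>
    have "W' (axis 1 1) = -4" "Hess W' (axis 1 1) = 0"
      by (simp_all add: W'_def Hess_weierstrass) (simp_all add: weierstrass_cubic_def even_cubic_def axis_components)
    then show ?thesis using main[of s "axis 1 1"] by simp
  qed
  have eq: "P * s - Q * s\<^sup>2 + R * s ^ 3 = 0"
    if "P = 2304 * (g2 - k\<^sup>2 * g2')" "Q = 663552 * (g3 - k ^ 3 * g3')"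
      "R = 1769472 * (g2\<^sup>2 - k ^ 4 * g2'\<^sup>2)" for P Q R s
    using that \<alpha>[of s] unfolding \<alpha>_def by algebra
  \<comment> \<open>A polynomial in \<open>s\<close> of degree at most 3 without constant term vanishes if it does so at \<open>1, -1, 2\<close>.\<close>
  have "P = 0 \<and> Q = 0" if "\<And>s. P * s - Q * s\<^sup>2 + R * s ^ 3 = 0" for P Q R :: complex
  proof -
    have 1: "P - Q + R = 0" and 2: "- P - Q - R = 0" and 3: "P * 2 - Q * 4 + R * 8 = 0"
      using that[of 1] that[of "-1"] that[of 2] by simp_all
    have "Q = 0" using 1 2 by algebra
    then show ?thesis using 1 3 by simp algebra
  qed
  from this[OF eq[OF refl refl refl]] have "g3 = k ^ 3 * g3'" "g2 = k\<^sup>2 * g2'"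
    by simp_all
  then show ?thesis using k by blast
qed

definition j_invariant :: "complex \<Rightarrow> complex \<Rightarrow> complex" where
  "j_invariant g2 g3 = 1728 * g2 ^ 3 / (g2 ^ 3 - 27 * g3\<^sup>2)"

text \<open>
  Numerator and denominator of the j-invariant are both weighted homogeneous of the same weight for
  the rescaling \<open>(g\<^sub>2, g\<^sub>3) \<mapsto> (k\<^sup>2 g\<^sub>2, k\<^sup>3 g\<^sub>3)\<close>.
\<close>
lemma j_invariant_cong:
  assumes "projectively_equivalent (weierstrass_cubic g2 g3) (weierstrass_cubic g2' g3')"
  shows "j_invariant g2 g3 = j_invariant g2' g3'"
proof -
  obtain k where k: "k \<noteq> 0" "g2 = k\<^sup>2 * g2'" "g3 = k ^ 3 * g3'"
    using weierstrass_equivalent_coefficients[OF assms] by blast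
  have "g2 ^ 3 = k ^ 6 * g2' ^ 3" "g3\<^sup>2 = k ^ 6 * g3'\<^sup>2"
    unfolding k(2,3) by algebra+
  then have "j_invariant g2 g3 = (k ^ 6 * (1728 * g2' ^ 3)) / (k ^ 6 * (g2' ^ 3 - 27 * g3'\<^sup>2))"
    unfolding j_invariant_def by (simp add: algebra_simps)
  then show ?thesis using k(1) by (simp add: j_invariant_def)
qed

text \<open>
  A singular point is a double root of \<open>4 x\<^sup>3 - g\<^sub>2 x - g\<^sub>3\<close> on the line \<open>y = 0\<close>;
  eliminating \<open>x\<close> from \<open>12 x\<^sup>2 = g\<^sub>2 z\<^sup>2\<close> and \<open>2 g\<^sub>2 x = - 3 g\<^sub>3 z\<close> shows that the discriminant vanishes.
\<close>
lemma weierstrass_nonsingular: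
  assumes "g2 ^ 3 - 27 * g3\<^sup>2 \<noteq> 0"
  shows "\<not> singular_point (weierstrass_cubic g2 g3) v"
proof
  assume v: "singular_point (weierstrass_cubic g2 g3) v"
  let ?x = "v $ 1" and ?y = "v $ 2" and ?z = "v $ 3"
  have "partial k (even_cubic 1 0 (-4) 0 g2 g3) v = 0" for k
    using v by (simp add: singular_point_def weierstrass_even_cubic)
  from this[of 1] this[of 2] this[of 3]
  have eqs: "12 * ?x\<^sup>2 = g2 * ?z\<^sup>2" "?y * ?z = 0" "?y\<^sup>2 + 2 * g2 * ?x * ?z + 3 * g3 * ?z\<^sup>2 = 0"
    by (simp_all add: partial_even_cubic)
  have "?z \<noteq> 0"
  proof
    assume "?z = 0"
    then have "v = 0" using eqs exhaust_3 by (auto simp: vec_eq_iff) (metis)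
    then show False using v by (simp add: singular_point_def)
  qed
  then have "?y = 0" and "2 * g2 * ?x = - 3 * g3 * ?z"
    using eqs(2,3) by (simp, algebra)
  then have "(g2 ^ 3 - 27 * g3\<^sup>2) * ?z\<^sup>2 = 0"
    using eqs(1) by algebra
  then show False using assms \<open>?z \<noteq> 0\<close> by simp
qed

lemma smooth_weierstrass:
  "g2 ^ 3 - 27 * g3\<^sup>2 \<noteq> 0 \<Longrightarrow> smooth_cubic (weierstrass_cubic g2 g3)"
  by (simp add: smooth_cubic_iff weierstrass_nonsingular)
    (simp add: weierstrass_even_cubic ternary_form_even_cubic)

text \<open>
  For \<open>g\<^sub>2 = 0\<close> the hessian is \<open>96 x (y\<^sup>2 - 3 g\<^sub>3 z\<^sup>2)\<close>, three lines of which two pass through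
  \<open>[1 : 0 : 0]\<close>.
\<close>
lemma Hess_weierstrass_equianharmonic_singular:
  "singular_point (Hess (weierstrass_cubic 0 g3)) (axis 1 1)"
proof -
  have "partial k (even_cubic 0 96 0 0 (- 288 * g3) 0) (axis 1 1) = 0" for k
    using exhaust_3[of k] by (auto simp: partial_even_cubic axis_components)
  then show ?thesis
    by (simp add: singular_point_def Hess_weierstrass)
      (simp add: even_cubic_def axis_components)
qed

text \<open>
  The Weierstrass coefficients, up to rescaling, of the hessian of the cubic with
  coefficients \<open>g\<^sub>2\<close> and \<open>g\<^sub>3\<close>.
\<close>
definition hess_g2 :: "complex \<Rightarrow> complex \<Rightarrow> complex" where
  "hess_g2 g2 g3 = (36 * g3\<^sup>2 - g2 ^ 3) / 48"

definition hess_g3 :: "complex \<Rightarrow> complex \<Rightarrow> complex" where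
  "hess_g3 g2 g3 = g3 * (g2 ^ 3 - 24 * g3\<^sup>2) / 192"

lemma Hess_weierstrass_substitution:
  fixes s :: complex
  assumes "g2\<^sup>2 * s = 48"
  shows "96 * s\<^sup>2 * (y\<^sup>2 * z - (4 * x ^ 3 - hess_g2 g2 g3 * x * z\<^sup>2 - hess_g3 g2 g3 * z ^ 3)) =
    (s * y)\<^sup>2 * (96 * z) - 96 * g2 * z\<^sup>2 * (s * (x - g3 * z / 4))
    - 288 * g3 * z * (s * (x - g3 * z / 4))\<^sup>2 - 8 * g2\<^sup>2 * (s * (x - g3 * z / 4)) ^ 3"
proof -
  define e where "e = g3 / 4"
  have e: "g3 = 4 * e" by (simp add: e_def)
  have "48 * hess_g2 g2 g3 = 36 * g3\<^sup>2 - g2 ^ 3" "192 * hess_g3 g2 g3 = g3 * (g2 ^ 3 - 24 * g3\<^sup>2)"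
    by (simp_all add: hess_g2_def hess_g3_def)
  then show ?thesis
    using assms unfolding e by simp algebra
qed

text \<open>
  The hessian is \<open>8 (12 x y\<^sup>2 - 12 g\<^sub>2 x\<^sup>2 z - 36 g\<^sub>3 x z\<^sup>2 - g\<^sub>2\<^sup>2 z\<^sup>3)\<close>. It has a flex at \<open>[0 : 1 : 0]\<close>
  with tangent \<open>x = 0\<close>, whereas a Weierstrass cubic has the tangent \<open>z = 0\<close> there. The substitution
  therefore exchanges \<open>x\<close> and \<open>z\<close>, scales by \<open>s\<close> to make the leading coefficients \<open>1\<close> and \<open>4\<close>, and
  completes the cube by the shift \<open>- g\<^sub>3 / 4\<close>.
\<close>
lemma Hess_weierstrass_normal_form:
  assumes "g2 \<noteq> 0"
  shows "projectively_equivalent (Hess (weierstrass_cubic g2 g3))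
    (weierstrass_cubic (hess_g2 g2 g3) (hess_g3 g2 g3))"
proof -
  define s where "s = 48 / g2\<^sup>2"
  have s: "s \<noteq> 0" "g2\<^sup>2 * s = 48" using assms by (auto simp: s_def)
  define A :: "complex ^ 3 ^ 3" where
    "A = vector [vector [0, 0, 1], vector [0, s, 0], vector [s, 0, - s * g3 / 4]]"
  have "det A = - s\<^sup>2"
    by (simp add: A_def det_3 power2_eq_square)
  then have "invertible A" using s by (simp add: invertible_det_nz)
  moreover have "Hess (weierstrass_cubic g2 g3) (A *v v) =
      (96 * s\<^sup>2) * weierstrass_cubic (hess_g2 g2 g3) (hess_g3 g2 g3) v" for v
  proof -
    have "(A *v v) $ 1 = v $ 3" "(A *v v) $ 2 = s * v $ 2" "(A *v v) $ 3 = s * (v $ 1 - g3 / 4 * v $ 3)"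
      by (simp_all add: A_def matrix_vector_mult_def sum_3 algebra_simps)
    then show ?thesis
      unfolding Hess_weierstrass even_cubic_def weierstrass_cubic_def
      by (simp add: Hess_weierstrass_substitution[OF s(2), symmetric])
  qed
  ultimately show ?thesis
    using s unfolding projectively_equivalent_def
    by (intro exI[of _ A] exI[of _ "96 * s\<^sup>2"]) auto
qed

section \<open>A family of cubic maps of the projective line\<close>

text \<open>
  The map \<open>z \<mapsto> - (z - c)\<^sup>3 / (27 z\<^sup>2)\<close>. The parameter allows for both coordinates: \<open>c = 4\<close> belongs to
  \<open>h\<close> and \<open>c = 6912 = 4 \<cdot> 1728\<close> to \<open>j\<close>.
\<close>
fun hess_formula :: "complex \<Rightarrow> P1 \<Rightarrow> P1" where
  "hess_formula c (Fin z) = P1_ratio (- ((z - c) ^ 3)) (27 * z\<^sup>2)"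
| "hess_formula c Infty = Infty"

lemma hess_formula_ratio:
  "hess_formula c (P1_ratio a b) = P1_ratio (- ((a - c * b) ^ 3)) (27 * a\<^sup>2 * b)"
proof (cases "a = 0 \<or> b = 0")
  case True
  then show ?thesis by (auto simp: P1_ratio_def)
next
  case False
  then have "a / b - c = (a - c * b) / b" by (simp add: field_simps)
  with False show ?thesis
    by (simp add: P1_ratio_def power_divide) (simp add: field_simps power2_eq_square power3_eq_cube)
qed

text \<open>
  In homogeneous coordinates an iteration step is \<open>(P, Q) \<mapsto> (- (P - c Q)\<^sup>3, 27 P\<^sup>2 Q)\<close>. It preserves
  coprimality because \<open>P - c Q\<close> has no common factor with \<open>P\<close> or \<open>Q\<close>, and it preserves the
  inequality of degrees, which says that \<open>\<infinity>\<close> is fixed.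
\<close>
lemma hess_formula_iterate:
  assumes "c \<noteq> 0"
  shows "\<exists>P Q. coprime P Q \<and> degree Q < degree P \<and>
    (\<forall>z. (hess_formula c ^^ n) (Fin z) = P1_ratio (poly P z) (poly Q z))"
proof (induction n)
  case 0
  show ?case
    by (intro exI[of _ "[:0, 1:]"] exI[of _ 1]) (simp add: P1_ratio_def)
next
  case (Suc n)
  then obtain P Q where PQ: "coprime P Q" "degree Q < degree P"
    "\<And>z. (hess_formula c ^^ n) (Fin z) = P1_ratio (poly P z) (poly Q z)" by blast
  define R where "R = P - smult c Q"
  have deg_R: "degree R = degree P"
    using PQ(2) degree_add_eq_left[of "- smult c Q" P] assms by (simp add: R_def)
  have "coprime R Q"
  proof (rule coprimeI)
    fix d assume d: "d dvd R" "d dvd Q"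
    then have "d dvd R + smult c Q" by (intro dvd_add dvd_smult)
    then show "is_unit d" using d PQ(1) coprime_common_divisor by (simp add: R_def) blast
  qed
  moreover have "coprime R P"
  proof (rule coprimeI)
    fix d assume d: "d dvd R" "d dvd P"
    then have "d dvd P - R" by (intro dvd_diff)
    then have "d dvd Q" using assms dvd_smult_cancel by (auto simp: R_def)
    then show "is_unit d" using d PQ(1) coprime_common_divisor by blast
  qed
  ultimately have "coprime (- (R ^ 3)) (P\<^sup>2 * Q)" by simp
  then have "coprime (- (R ^ 3)) (smult 27 (P\<^sup>2 * Q))"
    by (rule coprime_divisors[rotated 2]) (auto intro: smult_dvd)
  moreover have "degree (smult 27 (P\<^sup>2 * Q)) < degree (- (R ^ 3))"
  proof -
    have "degree (smult 27 (P\<^sup>2 * Q)) \<le> degree (P\<^sup>2) + degree Q"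
      by (simp add: degree_mult_le)
    also have "\<dots> < 3 * degree P"
      using PQ(2) degree_power_le[of P 2] by simp
    finally have "degree (smult 27 (P\<^sup>2 * Q)) < 3 * degree P" .
    moreover have "R \<noteq> 0" using PQ(2) deg_R by auto
    ultimately show ?thesis by (simp add: degree_power_eq deg_R)
  qed
  moreover have "(hess_formula c ^^ Suc n) (Fin z) =
      P1_ratio (poly (- (R ^ 3)) z) (poly (smult 27 (P\<^sup>2 * Q)) z)" for z
    by (simp add: PQ(3) hess_formula_ratio R_def mult.assoc)
  ultimately show ?case by blast
qed

lemma P1_morphism_hess_formula_iterate:
  assumes "c \<noteq> 0"
  shows "P1_morphism (hess_formula c ^^ n)"
proof -
  obtain P Q where PQ: "coprime P Q" "degree Q < degree P"
    "\<forall>z. (hess_formula c ^^ n) (Fin z) = P1_ratio (poly P z) (poly Q z)"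
    using hess_formula_iterate[OF assms] by blast
  have "(hess_formula c ^^ n) Infty = Infty"
    by (induction n) auto
  moreover have "P1_ratio (coeff P (degree P)) (coeff Q (degree P)) = Infty"
    using PQ(2) by (simp add: P1_ratio_def coeff_eq_0)
  ultimately show ?thesis
    using PQ unfolding P1_morphism_def
    by (intro exI[of _ P] exI[of _ Q]) (auto simp: max_def)
qed

text \<open>
  Agreement at infinitely many points gives \<open>p s = r q\<close> for the two reduced fractions \<open>p / q\<close> and
  \<open>r / s\<close>, so these differ by a constant factor. Asking for finite common values makes \<open>q\<close> and
  \<open>s\<close> nonzero.
\<close>
lemma P1_morphism_eqI:
  assumes "P1_morphism F" "P1_morphism G"
    and inf: "infinite {z. \<exists>w. F (Fin z) = Fin w \<and> G (Fin z) = Fin w}" (is "infinite ?S")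
  shows "F = G"
proof -
  obtain p q where F: "coprime p q" "\<And>z. F (Fin z) = P1_ratio (poly p z) (poly q z)"
    "F Infty = P1_ratio (coeff p (max (degree p) (degree q))) (coeff q (max (degree p) (degree q)))"
    using assms(1) unfolding P1_morphism_def Let_def by blast
  obtain r s where G: "coprime r s" "\<And>z. G (Fin z) = P1_ratio (poly r z) (poly s z)"
    "G Infty = P1_ratio (coeff r (max (degree r) (degree s))) (coeff s (max (degree r) (degree s)))"
    using assms(2) unfolding P1_morphism_def Let_def by blast
  have S: "poly q z \<noteq> 0" "poly s z \<noteq> 0" "poly (p * s - r * q) z = 0" if "z \<in> ?S" for z
  proof -
    have "P1_ratio (poly p z) (poly q z) \<noteq> Infty"
      "P1_ratio (poly r z) (poly s z) = P1_ratio (poly p z) (poly q z)"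
      using that by (auto simp: F(2) G(2))
    then show "poly q z \<noteq> 0" "poly s z \<noteq> 0" "poly (p * s - r * q) z = 0"
      by (auto simp: P1_ratio_def frac_eq_eq split: if_splits)
  qed
  obtain z where "z \<in> ?S" using infinite_imp_nonempty[OF inf] by (auto simp only: ex_in_conv[symmetric])
  then have "q \<noteq> 0" "s \<noteq> 0" using S(1,2)[of z] by auto
  have "p * s - r * q = 0"
  proof (rule ccontr)
    assume "p * s - r * q \<noteq> 0"
    then have "finite {z. poly (p * s - r * q) z = 0}" by (rule poly_roots_finite)
    moreover have "?S \<subseteq> {z. poly (p * s - r * q) z = 0}" using S by blast
    ultimately show False using inf finite_subset by blast
  qed
  then have eq: "p * s = r * q" by simp
  have "q dvd s"
  proof -
    have "q dvd p * s" by (simp add: eq)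
    moreover have "coprime q p" using F(1) by (simp add: coprime_commute)
    ultimately show ?thesis by (simp add: coprime_dvd_mult_right_iff)
  qed
  moreover have "s dvd q"
  proof -
    have "s dvd r * q" by (simp flip: eq)
    moreover have "coprime s r" using G(1) by (simp add: coprime_commute)
    ultimately show ?thesis by (simp add: coprime_dvd_mult_right_iff)
  qed
  ultimately obtain u where u: "s = smult u q" "u \<noteq> 0"
  proof -
    obtain k l where kl: "s = q * k" "q = s * l"
      using \<open>q dvd s\<close> \<open>s dvd q\<close> unfolding dvd_def by blast
    then have "q * (k * l) = q * 1" by (metis mult.assoc mult.right_neutral)
    then have "k * l = 1" using \<open>q \<noteq> 0\<close> mult_left_cancel by blast
    then have "is_unit k" by (metis dvd_triv_left)
    then obtain u where "k = [:u:]" "is_unit u"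
      using is_unit_poly_iff by blast
    then have "k = [:u:]" "u \<noteq> 0" by auto
    then show ?thesis using kl(1) that by (simp add: mult.commute)
  qed
  have "r = smult u p"
  proof -
    have "q * r = q * smult u p" using eq u(1) by (simp add: mult.commute)
    then show ?thesis using \<open>q \<noteq> 0\<close> mult_left_cancel by blast
  qed
  have "P1_ratio (u * a) (u * b) = P1_ratio a b" for a b
    using u(2) by (simp add: P1_ratio_def)
  then have "F x = G x" for x
    using u(2) by (cases x) (simp_all add: F(2,3) G(2,3) u(1) \<open>r = smult u p\<close>)
  then show ?thesis by blast
qed

section \<open>The hessian dynamical system in closed form\<close>

lemma has_j_invariant_iff:
  "has_j_invariant f j \<longleftrightarrow> (\<exists>g2 g3. g2 ^ 3 - 27 * g3\<^sup>2 \<noteq> 0 \<and>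
     projectively_equivalent f (weierstrass_cubic g2 g3) \<and> j = j_invariant g2 g3)"
  by (simp add: has_j_invariant_def j_invariant_def)

text \<open>
  In particular the hessian of a smooth Weierstrass cubic is smooth as soon as \<open>g\<^sub>2 \<noteq> 0\<close>.
\<close>
lemma hess_discriminant:
  "(hess_g2 g2 g3) ^ 3 - 27 * (hess_g3 g2 g3)\<^sup>2 = - (g2 ^ 6 * (g2 ^ 3 - 27 * g3\<^sup>2)) / 110592"
  unfolding hess_g2_def hess_g3_def by (simp add: field_simps) algebra

text \<open>
  With \<open>u = g\<^sub>2\<^sup>3\<close> and discriminant \<open>\<Delta>\<close> one has \<open>j = 1728 u / \<Delta>\<close>. The numerator of the new j-invariant is
  governed by \<open>144 hess_g2 = u - 4 \<Delta>\<close>, the source of the factor \<open>j - 6912\<close>, and its denominator by the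
  new discriminant, a multiple of \<open>u\<^sup>2 \<Delta>\<close>.
\<close>
lemma hess_formula_j_invariant:
  assumes "g2 \<noteq> 0" "g2 ^ 3 - 27 * g3\<^sup>2 \<noteq> 0"
  shows "hess_formula 6912 (Fin (j_invariant g2 g3)) =
    Fin (j_invariant (hess_g2 g2 g3) (hess_g3 g2 g3))"
proof -
  define u \<Delta> G where "u = g2 ^ 3" and "\<Delta> = g2 ^ 3 - 27 * g3\<^sup>2" and "G = hess_g2 g2 g3"
  have nz: "u \<noteq> 0" "\<Delta> \<noteq> 0" using assms by (auto simp: u_def \<Delta>_def)
  have j: "j_invariant g2 g3 = 1728 * u / \<Delta>"
    by (simp add: j_invariant_def u_def \<Delta>_def)
  have u: "u = 4 * \<Delta> + 144 * G"
  proof -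
    have "48 * G = 36 * g3\<^sup>2 - g2 ^ 3" by (simp add: G_def hess_g2_def)
    then show ?thesis unfolding u_def \<Delta>_def by algebra
  qed
  have sub: "j_invariant g2 g3 - 6912 = 1728 * 144 * G / \<Delta>"
  proof -
    have "1728 * u - 6912 * \<Delta> = 1728 * 144 * G" using u by algebra
    moreover have "j_invariant g2 g3 - 6912 = (1728 * u - 6912 * \<Delta>) / \<Delta>"
      using nz(2) by (simp add: j diff_divide_distrib)
    ultimately show ?thesis by simp
  qed
  have "hess_formula 6912 (Fin (j_invariant g2 g3)) =
      Fin (- ((1728 * 144 * G / \<Delta>) ^ 3) / (27 * (1728 * u / \<Delta>)\<^sup>2))"
    using nz by (simp only: hess_formula.simps sub) (simp add: P1_ratio_def j)
  also have "- ((1728 * 144 * G / \<Delta>) ^ 3) / (27 * (1728 * u / \<Delta>)\<^sup>2) =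
      1728 * G ^ 3 / (- (u\<^sup>2 * \<Delta>) / 110592)"
  proof -
    have "- ((1728 * 144 * G / \<Delta>) ^ 3) = - (248832 ^ 3 * G ^ 3) / \<Delta> ^ 3"
      by (simp add: power_divide power_mult_distrib)
    moreover have "27 * (1728 * u / \<Delta>)\<^sup>2 = 80621568 * u\<^sup>2 / \<Delta>\<^sup>2"
      by (simp add: power_divide power_mult_distrib)
    moreover have "- (248832 ^ 3 * G ^ 3) / \<Delta> ^ 3 / (80621568 * u\<^sup>2 / \<Delta>\<^sup>2) =
        - (191102976 * G ^ 3) / (u\<^sup>2 * \<Delta>)"
      using nz by (simp add: power2_eq_square power3_eq_cube mult_ac)
    ultimately show ?thesis by simp
  qed
  also have "\<dots> = j_invariant (hess_g2 g2 g3) (hess_g3 g2 g3)"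
    unfolding j_invariant_def hess_discriminant
    by (simp add: G_def u_def \<Delta>_def flip: power_mult)
  finally show ?thesis .
qed

lemma weierstrass_with_j_invariant:
  assumes "j \<noteq> 0"
  shows "\<exists>g2 g3. g2 \<noteq> 0 \<and> g2 ^ 3 - 27 * g3\<^sup>2 \<noteq> 0 \<and> j = j_invariant g2 g3"
proof -
  \<comment> \<open>Solves \<open>j = 1728 / (1 - g\<^sub>3\<^sup>2)\<close>, the j-invariant for \<open>g\<^sub>2 = 3\<close>.\<close>
  define g3 where "g3 = csqrt (1 - 1728 / j)"
  have "3 ^ 3 - 27 * g3\<^sup>2 = 46656 / j" by (simp add: g3_def)
  then show ?thesis using assms
    by (intro exI[of _ 3] exI[of _ g3]) (simp add: j_invariant_def)
qed

text \<open>
  Existence: a smooth cubic with smooth hessian is equivalent to a Weierstrass cubic with \<open>g\<^sub>2 \<noteq> 0\<close>,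
  and then the j-invariant of the hessian is known in closed form. Uniqueness: the defining
  condition prescribes a finite value at every nonzero \<open>j\<close>.
\<close>
lemma hessian_map_eq: "hessian_map = hess_formula 6912"
  unfolding hessian_map_def
proof (rule the_equality, intro conjI allI impI)
  show "P1_morphism (hess_formula 6912)"
    using P1_morphism_hess_formula_iterate[of 6912 1] by simp
next
  fix f j j'
  assume smooth: "smooth_cubic f \<and> smooth_cubic (Hess f)"
    and jj': "has_j_invariant f j \<and> has_j_invariant (Hess f) j'"
  obtain g2 g3 where g: "g2 ^ 3 - 27 * g3\<^sup>2 \<noteq> 0"
    "projectively_equivalent f (weierstrass_cubic g2 g3)" "j = j_invariant g2 g3"
    using jj' unfolding has_j_invariant_iff by blast
  obtain a b where ab: "projectively_equivalent (Hess f) (weierstrass_cubic a b)"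
    "j' = j_invariant a b"
    using jj' unfolding has_j_invariant_iff by blast
  have f: "poly_fun f" using smooth by (auto simp: smooth_cubic_def intro: ternary_form_poly_fun)
  have Hess_eq: "projectively_equivalent (Hess f) (Hess (weierstrass_cubic g2 g3))"
    by (intro projectively_equivalent_Hess f g(2) poly_fun_weierstrass)
  have "g2 \<noteq> 0"
  proof
    assume "g2 = 0"
    then have "\<exists>w. singular_point (Hess f) w"
      using singular_point_transfer[OF poly_fun_Hess[OF poly_fun_weierstrass] Hess_eq]
        Hess_weierstrass_equianharmonic_singular by blast
    then show False using smooth by (simp add: smooth_cubic_iff)
  qed
  have "projectively_equivalent (weierstrass_cubic (hess_g2 g2 g3) (hess_g3 g2 g3))
      (weierstrass_cubic a b)"
    using Hess_weierstrass_normal_form[OF \<open>g2 \<noteq> 0\<close>] Hess_eq ab(1)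
    by (meson projectively_equivalent_sym projectively_equivalent_trans)
  then have "j' = j_invariant (hess_g2 g2 g3) (hess_g3 g2 g3)"
    using j_invariant_cong ab(2) by simp
  then show "hess_formula 6912 (Fin j) = Fin j'"
    using hess_formula_j_invariant[OF \<open>g2 \<noteq> 0\<close> g(1)] g(3) by simp
next
  fix H
  assume H: "P1_morphism H \<and>
     (\<forall>f. smooth_cubic f \<and> smooth_cubic (Hess f) \<longrightarrow>
       (\<forall>j j'. has_j_invariant f j \<and> has_j_invariant (Hess f) j' \<longrightarrow> H (Fin j) = Fin j'))"
  have agree: "\<exists>w. H (Fin j) = Fin w \<and> hess_formula 6912 (Fin j) = Fin w" if j: "j \<noteq> 0" for j
  proof -
    obtain g2 g3 where g: "g2 \<noteq> 0" "g2 ^ 3 - 27 * g3\<^sup>2 \<noteq> 0" "j = j_invariant g2 g3"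
      using weierstrass_with_j_invariant[OF j] by blast
    let ?W = "weierstrass_cubic g2 g3"
    let ?W' = "weierstrass_cubic (hess_g2 g2 g3) (hess_g3 g2 g3)"
    have disc: "(hess_g2 g2 g3) ^ 3 - 27 * (hess_g3 g2 g3)\<^sup>2 \<noteq> 0"
      using g(1,2) by (simp add: hess_discriminant)
    have eq: "projectively_equivalent (Hess ?W) ?W'"
      by (rule Hess_weierstrass_normal_form[OF g(1)])
    have "\<not> singular_point (Hess ?W) v" for v
      using singular_point_transfer[OF poly_fun_Hess[OF poly_fun_weierstrass]
          projectively_equivalent_sym[OF eq]] weierstrass_nonsingular[OF disc] by blast
    then have "smooth_cubic (Hess ?W)"
      by (simp add: smooth_cubic_iff) (simp add: Hess_weierstrass ternary_form_even_cubic)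
    moreover have "smooth_cubic ?W" by (rule smooth_weierstrass[OF g(2)])
    moreover have "has_j_invariant ?W j"
      using g(2,3) projectively_equivalent_refl has_j_invariant_iff by blast
    moreover have "has_j_invariant (Hess ?W) (j_invariant (hess_g2 g2 g3) (hess_g3 g2 g3))"
      using disc eq has_j_invariant_iff by blast
    ultimately have "H (Fin j) = Fin (j_invariant (hess_g2 g2 g3) (hess_g3 g2 g3))"
      using H by blast
    then show ?thesis using hess_formula_j_invariant[OF g(1,2)] g(3) by simp
  qed
  show "H = hess_formula 6912"
  proof (rule P1_morphism_eqI)
    show "P1_morphism H" using H by blast
    show "P1_morphism (hess_formula 6912)"
      using P1_morphism_hess_formula_iterate[of 6912 1] by simp
    have "infinite (UNIV - {0 :: complex})"
      by (simp add: infinite_UNIV_char_0)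
    moreover have "UNIV - {0} \<subseteq> {z. \<exists>w. H (Fin z) = Fin w \<and> hess_formula 6912 (Fin z) = Fin w}"
      using agree by blast
    ultimately show "infinite {z. \<exists>w. H (Fin z) = Fin w \<and> hess_formula 6912 (Fin z) = Fin w}"
      using finite_subset by blast
  qed
qed

lemma hessian_map_h_eq: "hessian_map_h = hess_formula 4"
proof
  fix x show "hessian_map_h x = hess_formula 4 x"
  proof (cases x)
    case (Fin h)
    have "1728 * h - 6912 = 1728 * (h - 4)" by simp
    then have "(1728 * h - 6912) ^ 3 = 1728 ^ 3 * (h - 4) ^ 3"
      by (simp only: power_mult_distrib)
    then show ?thesis
      by (simp only: Fin hessian_map_h_def hessian_map_eq o_apply j_of_h.simps hess_formula.simps)
        (auto simp: P1_ratio_def power_mult_distrib)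
  next
    case Infty
    then show ?thesis by (simp add: hessian_map_h_def hessian_map_eq)
  qed
qed

section \<open>Derivatives in charts\<close>

text \<open>
  The points at which \<open>coord_at\<close> inverts \<open>param_at\<close>; a neighbourhood of the centre.
\<close>
fun chart_domain :: "P1 \<Rightarrow> P1 set" where
  "chart_domain (Fin a) = - {Infty}"
| "chart_domain Infty = - {Fin 0}"

text \<open>
  The first condition says that \<open>f\<close> stays inside the target chart near \<open>x\<close>. Without it the junk values of
  \<open>coord_at\<close> outside the chart would break the chain rule.
\<close>
definition chart_derivative :: "(P1 \<Rightarrow> P1) \<Rightarrow> P1 \<Rightarrow> complex \<Rightarrow> bool" where
  "chart_derivative f x D \<longleftrightarrow>
     (\<forall>\<^sub>F t in nhds 0. f (param_at x t) \<in> chart_domain (f x)) \<and>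
     ((\<lambda>t. coord_at (f x) (f (param_at x t))) has_field_derivative D) (at 0)"

lemma param_at_coord_at: "y \<in> chart_domain x \<Longrightarrow> param_at x (coord_at x y) = y"
  by (cases x; cases y) (auto simp: P1_ratio_def)

lemma param_at_0: "param_at x 0 = x"
  by (cases x) (auto simp: P1_ratio_def)

lemma coord_at_self: "coord_at x x = 0"
  by (cases x) auto

lemma critical_point_iff:
  "chart_derivative f x D \<Longrightarrow> critical_point f x \<longleftrightarrow> D = 0"
  unfolding chart_derivative_def critical_point_def by (auto dest: DERIV_unique)

lemma chart_derivative_id: "chart_derivative id x 1"
proof (cases x)
  case (Fin a)
  then show ?thesis by (auto simp: chart_derivative_def intro!: derivative_eq_intros)
next
  case Infty
  have "coord_at Infty (P1_ratio 1 t) = t" for t by (simp add: P1_ratio_def)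
  with Infty show ?thesis by (auto simp: chart_derivative_def P1_ratio_def)
qed

text \<open>
  Near the centre the composite in charts is the composite of the two chart expressions, since the
  intermediate point can be recovered from its coordinate.
\<close>
lemma chart_derivative_compose:
  assumes f: "chart_derivative f x D" and g: "chart_derivative g (f x) E"
  shows "chart_derivative (g \<circ> f) x (E * D)"
proof -
  define \<phi> where "\<phi> t = coord_at (f x) (f (param_at x t))" for t
  define \<psi> where "\<psi> t = coord_at (g (f x)) (g (param_at (f x) t))" for t
  have \<phi>0: "\<phi> 0 = 0" by (simp add: \<phi>_def param_at_0 coord_at_self)
  have d\<phi>: "(\<phi> has_field_derivative D) (at 0)" and d\<psi>: "(\<psi> has_field_derivative E) (at (\<phi> 0))"
    using f g unfolding chart_derivative_def \<phi>0 by (auto simp: \<phi>_def[abs_def] \<psi>_def[abs_def])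
  have ev: "\<forall>\<^sub>F t in nhds 0. f (param_at x t) = param_at (f x) (\<phi> t)"
    using f unfolding chart_derivative_def
    by (auto elim!: eventually_mono simp: \<phi>_def param_at_coord_at)
  have "((\<lambda>t. \<psi> (\<phi> t)) has_field_derivative E * D) (at 0)"
    by (rule DERIV_chain2[OF d\<psi> d\<phi>])
  moreover have "\<forall>\<^sub>F t in nhds 0. coord_at ((g \<circ> f) x) ((g \<circ> f) (param_at x t)) = \<psi> (\<phi> t)"
    using ev by eventually_elim (simp add: \<psi>_def)
  ultimately have "((\<lambda>t. coord_at ((g \<circ> f) x) ((g \<circ> f) (param_at x t)))
      has_field_derivative E * D) (at 0)"
    by (subst DERIV_cong_ev[OF refl _ refl]) auto
  moreover have "\<forall>\<^sub>F t in nhds 0. (g \<circ> f) (param_at x t) \<in> chart_domain ((g \<circ> f) x)"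
  proof -
    have "filterlim \<phi> (nhds 0) (nhds 0)"
      using DERIV_isCont[OF d\<phi>] \<phi>0 tendsto_at_iff_tendsto_nhds[of \<phi> 0] by (simp add: isCont_def)
    moreover have "\<forall>\<^sub>F t in nhds 0. g (param_at (f x) t) \<in> chart_domain (g (f x))"
      using g unfolding chart_derivative_def by blast
    ultimately have "\<forall>\<^sub>F t in nhds 0. g (param_at (f x) (\<phi> t)) \<in> chart_domain (g (f x))"
      by (rule eventually_compose_filterlim[rotated])
    with ev show ?thesis by eventually_elim simp
  qed
  ultimately show ?thesis unfolding chart_derivative_def by blast
qed

lemma chart_derivative_funpow:
  assumes "\<And>x. chart_derivative f x (d x)"
  shows "chart_derivative (f ^^ n) x (\<Prod>k<n. d ((f ^^ k) x))"
proof (induction n)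
  case 0
  show ?case using chart_derivative_id[of x] by (simp add: id_def)
next
  case (Suc n)
  show ?case
    using chart_derivative_compose[OF Suc assms] by (simp add: mult.commute comp_def)
qed

lemma chart_derivativeI:
  assumes "(\<phi> has_field_derivative D) (at 0)"
    and "\<forall>\<^sub>F t in nhds 0. f (param_at x t) \<in> chart_domain (f x) \<and>
       coord_at (f x) (f (param_at x t)) = \<phi> t"
  shows "chart_derivative f x D"
  unfolding chart_derivative_def
proof
  show "\<forall>\<^sub>F t in nhds 0. f (param_at x t) \<in> chart_domain (f x)"
    using assms(2) by eventually_elim simp
  have "\<forall>\<^sub>F t in nhds 0. coord_at (f x) (f (param_at x t)) = \<phi> t"
    using assms(2) by eventually_elim simp
  from DERIV_cong_ev[OF refl this refl] assms(1)
  show "((\<lambda>t. coord_at (f x) (f (param_at x t))) has_field_derivative D) (at 0)"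
    by blast
qed

section \<open>Critical points and fibres of the iterates\<close>

text \<open>
  At a finite \<open>a \<noteq> 0\<close> the derivative is \<open>- (a - 4)\<^sup>2 (a + 8) / (27 a\<^sup>3)\<close>. Near \<open>0\<close> the reciprocal of
  the map is \<open>- 27 t\<^sup>2 / (t - 4)\<^sup>3\<close>, with a double zero, so \<open>0\<close> is critical. At \<open>\<infinity>\<close>, in the
  coordinate \<open>t = 1 / z\<close>, the reciprocal is \<open>- 27 t / (1 - 4 t)\<^sup>3\<close>, with a simple zero.
\<close>
lemma hess_formula_chart_derivative:
  "\<exists>D. chart_derivative (hess_formula 4) x D \<and> (D = 0 \<longleftrightarrow> x \<in> {Fin 0, Fin 4, Fin (-8)})"
proof (cases x)
  case Infty
  define \<phi> :: "complex \<Rightarrow> complex" where "\<phi> t = - 27 * t / (1 - 4 * t) ^ 3" for t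
  have "(\<phi> has_field_derivative - 27) (at 0)"
    unfolding \<phi>_def by (auto intro!: derivative_eq_intros)
  moreover have "\<forall>\<^sub>F t in nhds 0. hess_formula 4 (param_at x t) \<in> chart_domain (hess_formula 4 x) \<and>
      coord_at (hess_formula 4 x) (hess_formula 4 (param_at x t)) = \<phi> t"
    using t1_space_nhds[of 0 "1/4 :: complex", simplified]
  proof eventually_elim
    case (elim t)
    then have "1 - 4 * t \<noteq> 0" by (auto simp: field_simps)
    then show ?case
      by (simp add: Infty hess_formula_ratio) (auto simp: P1_ratio_def \<phi>_def)
  qed
  ultimately have "chart_derivative (hess_formula 4) x (- 27)" by (rule chart_derivativeI)
  with Infty show ?thesis by (intro exI[of _ "- 27"]) simp
next
  case (Fin a)
  show ?thesis
  proof (cases "a = 0")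
    case True
    define \<phi> :: "complex \<Rightarrow> complex" where "\<phi> t = - 27 * t\<^sup>2 / (t - 4) ^ 3" for t
    have "(\<phi> has_field_derivative 0) (at 0)"
      unfolding \<phi>_def by (auto intro!: derivative_eq_intros)
    moreover have "\<forall>\<^sub>F t in nhds 0. hess_formula 4 (param_at x t) \<in> chart_domain (hess_formula 4 x) \<and>
        coord_at (hess_formula 4 x) (hess_formula 4 (param_at x t)) = \<phi> t"
      using t1_space_nhds[of 0 "4 :: complex", simplified]
      by eventually_elim (auto simp: Fin True P1_ratio_def \<phi>_def)
    ultimately have "chart_derivative (hess_formula 4) x 0" by (rule chart_derivativeI)
    with Fin True show ?thesis by (intro exI[of _ 0]) simp
  next
    case False
    define \<phi> :: "complex \<Rightarrow> complex" where "\<phi> t = - ((a + t - 4) ^ 3) / (27 * (a + t)\<^sup>2)" for t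
    define D where "D = - ((a - 4)\<^sup>2 * (a + 8)) / (27 * a ^ 3)"
    have "((\<lambda>t. \<phi> t - \<phi> 0) has_field_derivative D) (at 0)"
      unfolding \<phi>_def D_def using False
      by (auto intro!: derivative_eq_intros)
        (simp add: field_simps power2_eq_square power3_eq_cube power4_eq_xxxx)
    moreover have "\<forall>\<^sub>F t in nhds 0. t \<noteq> - a"
      using False by (intro t1_space_nhds) simp
    then have "\<forall>\<^sub>F t in nhds 0. hess_formula 4 (param_at x t) \<in> chart_domain (hess_formula 4 x) \<and>
        coord_at (hess_formula 4 x) (hess_formula 4 (param_at x t)) = \<phi> t - \<phi> 0"
      by eventually_elim (auto simp: Fin False P1_ratio_def \<phi>_def add_eq_0_iff)
    ultimately have "chart_derivative (hess_formula 4) x D" by (rule chart_derivativeI)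
    moreover have "D = 0 \<longleftrightarrow> x \<in> {Fin 0, Fin 4, Fin (-8)}"
      using False by (auto simp: D_def Fin add_eq_0_iff2)
    ultimately show ?thesis by blast
  qed
qed

text \<open>
  By the chain rule the derivative of the iterate is the product of the derivatives along the orbit.
\<close>
lemma critical_point_hess_formula_iterate:
  "critical_point (hess_formula 4 ^^ n) x \<longleftrightarrow>
     (\<exists>k<n. (hess_formula 4 ^^ k) x \<in> {Fin 0, Fin 4, Fin (-8)})"
proof -
  obtain d where d: "\<And>x. chart_derivative (hess_formula 4) x (d x)"
    "\<And>x. d x = 0 \<longleftrightarrow> x \<in> {Fin 0, Fin 4, Fin (-8)}"
    using hess_formula_chart_derivative by metis
  show ?thesis
    by (subst critical_point_iff[OF chart_derivative_funpow[OF d(1)]]) (auto simp: d(2))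
qed

text \<open>
  The polynomial is \<open>- (z - 4)\<^sup>3 - 27 w z\<^sup>2\<close>, obtained by clearing denominators. Its value \<open>64\<close> at
  \<open>z = 0\<close> excludes the pole.
\<close>
lemma hess_formula_eq_Fin_iff:
  "hess_formula 4 (Fin z) = Fin w \<longleftrightarrow> poly [:64, - 48, 12 - 27 * w, - 1:] z = 0"
proof (cases "z = 0")
  case False
  then have "hess_formula 4 (Fin z) = Fin w \<longleftrightarrow> - ((z - 4) ^ 3) = w * (27 * z\<^sup>2)"
    by (auto simp: P1_ratio_def field_simps)
  also have "\<dots> \<longleftrightarrow> poly [:64, - 48, 12 - 27 * w, - 1:] z = 0"
    by (simp add: algebra_simps power2_eq_square power3_eq_cube)
  finally show ?thesis .
qed (simp add: P1_ratio_def)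

lemma surj_hess_formula: "surj (hess_formula 4)"
proof -
  have "\<exists>x. hess_formula 4 x = y" for y
  proof (cases y)
    case (Fin w)
    have "\<not> constant (poly [:64, - 48, 12 - 27 * w, - 1:])"
      by (simp add: constant_degree)
    then obtain z where "poly [:64, - 48, 12 - 27 * w, - 1:] z = 0"
      using fundamental_theorem_of_algebra by blast
    then show ?thesis using Fin hess_formula_eq_Fin_iff by blast
  qed (auto intro: exI[of _ Infty])
  then show ?thesis by (metis surj_def)
qed

lemma finite_fibre_hess_formula: "finite (hess_formula 4 -` {y})"
proof (cases y)
  case (Fin w)
  let ?p = "[:64, - 48, 12 - 27 * w, - 1:]"
  have "hess_formula 4 -` {y} \<subseteq> Fin ` {z. poly ?p z = 0}"
  proof
    fix x assume "x \<in> hess_formula 4 -` {y}"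
    then show "x \<in> Fin ` {z. poly ?p z = 0}"
      using Fin hess_formula_eq_Fin_iff[of _ w] by (cases x) auto
  qed
  moreover have "finite {z. poly ?p z = 0}" by (rule poly_roots_finite) simp
  ultimately show ?thesis using finite_surj by blast
next
  case Infty
  have "hess_formula 4 -` {y} \<subseteq> {Fin 0, Infty}"
  proof
    fix x assume "x \<in> hess_formula 4 -` {y}"
    then show "x \<in> {Fin 0, Infty}"
      using Infty by (cases x) (auto simp: P1_ratio_def split: if_splits)
  qed
  then show ?thesis using finite_subset by blast
qed

lemma finite_fibre_funpow:
  fixes f :: "'a \<Rightarrow> 'a"
  assumes "\<And>y. finite (f -` {y})" "finite A"
  shows "finite ((f ^^ n) -` A)"
  using assms(2)
proof (induction n arbitrary: A)
  case (Suc n)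
  have "f -` A = (\<Union>y\<in>A. f -` {y})" by blast
  then have "finite (f -` A)" using Suc.prems assms(1) by simp
  then have "finite ((f ^^ n) -` (f -` A))" by (rule Suc.IH)
  then show ?case by (simp add: vimage_comp comp_def)
qed simp

lemma hess_formula_values:
  "hess_formula 4 (Fin 0) = Infty" "hess_formula 4 (Fin 1) = Fin 1"
  "hess_formula 4 (Fin 4) = Fin 0" "hess_formula 4 (Fin (-8)) = Fin 1"
  by (simp_all add: P1_ratio_def)

text \<open>
  A critical orbit enters \<open>{0, 1, \<infinity>}\<close> one step after meeting a critical point of the map and never
  leaves it again. Conversely, a preimage of a critical point under the iterate of order \<open>n - 1\<close> is
  critical for the iterate of order \<open>n\<close>.
\<close>
lemma critical_values_hess_formula_iterate:
  assumes "n \<ge> 1"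
  shows "critical_values (hess_formula 4 ^^ n) = {Fin 0, Fin 1, Infty}"
proof
  let ?F = "hess_formula 4" and ?V = "{Fin 0, Fin 1, Infty}" and ?C = "{Fin 0, Fin 4, Fin (-8)}"
  have step: "?F y \<in> ?V" if "y \<in> ?V \<union> ?C" for y
    using that hess_formula_values by auto
  have orbit: "(?F ^^ m) y \<in> ?V" if "y \<in> ?V" for m y
  proof (induction m)
    case (Suc m)
    have "?F ((?F ^^ m) y) \<in> ?V" by (rule step[OF UnI1[OF Suc]])
    then show ?case by (simp only: funpow.simps o_apply)
  qed (use that in simp)
  show "critical_values (?F ^^ n) \<subseteq> ?V"
  proof
    fix y assume "y \<in> critical_values (?F ^^ n)"
    then obtain x k where x: "y = (?F ^^ n) x" and k: "k < n" "(?F ^^ k) x \<in> ?C"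
      unfolding critical_values_def critical_point_hess_formula_iterate by blast
    have "y = (?F ^^ (n - Suc k + Suc k)) x" using x k(1) by simp
    also have "\<dots> = (?F ^^ (n - Suc k)) (?F ((?F ^^ k) x))"
      by (simp only: funpow_add funpow.simps o_apply)
    finally show "y \<in> ?V" by (simp only: orbit[OF step[OF UnI2[OF k(2)]]])
  qed
  show "?V \<subseteq> critical_values (?F ^^ n)"
  proof -
    obtain m where n: "n = Suc m" using assms by (cases n) auto
    have crit: "?F c \<in> critical_values (?F ^^ n)" if "c \<in> ?C" for c
    proof -
      have "surj (?F ^^ m)" using surj_hess_formula by (rule surj_fn)
      then obtain x where x: "c = (?F ^^ m) x" by (metis surjD)
      then have "critical_point (?F ^^ n) x"
        unfolding critical_point_hess_formula_iterate using that n by blast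
      then have "(?F ^^ n) x \<in> critical_values (?F ^^ n)"
        unfolding critical_values_def by (intro imageI CollectI)
      moreover have "(?F ^^ n) x = ?F c" by (simp only: n x funpow.simps o_apply)
      ultimately show ?thesis by (simp only:)
    qed
    show ?thesis
      using crit[of "Fin 0"] crit[of "Fin 4"] crit[of "Fin (-8)"]
      unfolding hess_formula_values by blast
  qed
qed

theorem proposition4p5:
  fixes n :: nat
  assumes "n \<ge> 1"
  shows "ramified_cover (hessian_map_h ^^ n) \<and>
    critical_values (hessian_map_h ^^ n) = {Fin 0, Fin 1, Infty}"
proof
  have "surj (hess_formula 4 ^^ n)" using surj_hess_formula by (rule surj_fn)
  moreover have "finite ((hess_formula 4 ^^ n) -` {w})" for w
    by (rule finite_fibre_funpow[OF finite_fibre_hess_formula]) simp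
  ultimately show "ramified_cover (hessian_map_h ^^ n)"
    unfolding ramified_cover_def hessian_map_h_eq
    using P1_morphism_hess_formula_iterate[of 4 n] by simp
  show "critical_values (hessian_map_h ^^ n) = {Fin 0, Fin 1, Infty}"
    unfolding hessian_map_h_eq by (rule critical_values_hess_formula_iterate[OF assms])
qed

end
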